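(* Let $M$ be a transversal matroid of rank $r$ and let $\mathcal{A}=(A_i:i\in[r])$ and $\mathcal{B}=(B_i:i\in[r])$ be presentations of $M$ with $\mathcal{A}\preceq\mathcal{B}$. Then $L_\mathcal{B}$ is a sublattice of $L_\mathcal{A}$, and $M[\mathcal{A}^I]=M[\mathcal{B}^I]$ for all $I\in L_\mathcal{B}$.
   Context: $[r]=\{1,\dots,r\}$. For a set system $\mathcal{A}=(A_i:i\in[r])$ on a finite set $E$, $M[\mathcal{A}]$ is the transversal matroid on $E$ whose independent sets are the partial transversals of $\mathcal{A}$ (sets $X\subseteq E$ admitting an injection $\phi:X\to[r]$ with $e\in A_{\phi(e)}$); $\mathcal{A}$ is a presentation of $M[\mathcal{A}]$. Presentations of a rank-$r$ transversal matroid are taken to have exactly $r$ sets. For presentations $\mathcal{A},\mathcal{B}$ of the same matroid, $\mathcal{A}\preceq\mathcal{B}$ means $A_i\subseteq B_i$ for all $i\in[r]$. Fix $x\notin E$; for $I\subseteq[r]$, $\mathcal{A}^I$ is obtained by replacing $A_i$ by $A_i\cup\{x\}$ for each $i\in I$. Let $\sigma_\mathcal{A}(I)=I\cup\{k\in[r]-I: x\text{ is a coloop of } M[\mathcal{A}^I]\backslash A_k\}$; $L_\mathcal{A}$ is the lattice (under inclusion, with join $\cup$ and meet $\cap$) of sets $I\subseteq[r]$ with $\sigma_\mathcal{A}(I)=I$. Similarly for $\mathcal{B}$. *)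

theory Defs
  imports Main
begin

record 'a matroid_data =
  ground :: "'a set"
  indeps :: "'a set set"

definition matroid :: "'a matroid_data \<Rightarrow> bool" where
  "matroid M \<longleftrightarrow>
     finite (ground M) \<and>
     (\<forall>X\<in>indeps M. X \<subseteq> ground M) \<and>
     {} \<in> indeps M \<and>
     (\<forall>X\<in>indeps M. \<forall>Y. Y \<subseteq> X \<longrightarrow> Y \<in> indeps M) \<and>
     (\<forall>X\<in>indeps M. \<forall>Y\<in>indeps M. card X < card Y \<longrightarrow>
        (\<exists>e\<in>Y - X. insert e X \<in> indeps M))"

definition bases :: "'a matroid_data \<Rightarrow> 'a set set" where
  "bases M = {B \<in> indeps M. \<forall>X\<in>indeps M. B \<subseteq> X \<longrightarrow> X = B}"

definition matroid_rank :: "'a matroid_data \<Rightarrow> nat" where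
  "matroid_rank M = Max (card ` indeps M)"

definition deletion :: "'a matroid_data \<Rightarrow> 'a set \<Rightarrow> 'a matroid_data" where
  "deletion M D = \<lparr>ground = ground M - D, indeps = {X \<in> indeps M. X \<subseteq> ground M - D}\<rparr>"

definition coloop :: "'a matroid_data \<Rightarrow> 'a \<Rightarrow> bool" where
  "coloop M e \<longleftrightarrow> e \<in> ground M \<and> (\<forall>B\<in>bases M. e \<in> B)"

text \<open>A set system \<open>(A\<^sub>i : i \<in> [r])\<close> is a function on \<open>nat\<close>; only its values on \<open>{1..r}\<close> matter.\<close>

definition set_system :: "'a set \<Rightarrow> nat \<Rightarrow> (nat \<Rightarrow> 'a set) \<Rightarrow> bool" where
  "set_system E r A \<longleftrightarrow> finite E \<and> (\<forall>i\<in>{1..r}. A i \<subseteq> E)"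

definition partial_transversal :: "nat \<Rightarrow> (nat \<Rightarrow> 'a set) \<Rightarrow> 'a set \<Rightarrow> bool" where
  "partial_transversal r A X \<longleftrightarrow>
     (\<exists>\<phi>. inj_on \<phi> X \<and> (\<forall>e\<in>X. \<phi> e \<in> {1..r} \<and> e \<in> A (\<phi> e)))"

definition transversal_matroid_of :: "'a set \<Rightarrow> nat \<Rightarrow> (nat \<Rightarrow> 'a set) \<Rightarrow> 'a matroid_data" where
  "transversal_matroid_of E r A =
     \<lparr>ground = E, indeps = {X. X \<subseteq> E \<and> partial_transversal r A X}\<rparr>"

definition presentation :: "'a matroid_data \<Rightarrow> nat \<Rightarrow> (nat \<Rightarrow> 'a set) \<Rightarrow> bool" where
  "presentation M r A \<longleftrightarrow>
     set_system (ground M) r A \<and> M = transversal_matroid_of (ground M) r A"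

definition transversal_matroid :: "'a matroid_data \<Rightarrow> bool" where
  "transversal_matroid M \<longleftrightarrow> matroid M \<and> (\<exists>n A. presentation M n A)"

definition system_le :: "nat \<Rightarrow> (nat \<Rightarrow> 'a set) \<Rightarrow> (nat \<Rightarrow> 'a set) \<Rightarrow> bool" where
  "system_le r A B \<longleftrightarrow> (\<forall>i\<in>{1..r}. A i \<subseteq> B i)"

definition extend_system :: "'a \<Rightarrow> (nat \<Rightarrow> 'a set) \<Rightarrow> nat set \<Rightarrow> nat \<Rightarrow> 'a set" where
  "extend_system x A I = (\<lambda>i. if i \<in> I then A i \<union> {x} else A i)"

definition extension_matroid ::
    "'a set \<Rightarrow> 'a \<Rightarrow> nat \<Rightarrow> (nat \<Rightarrow> 'a set) \<Rightarrow> nat set \<Rightarrow> 'a matroid_data" where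
  "extension_matroid E x r A I = transversal_matroid_of (E \<union> {x}) r (extend_system x A I)"

definition sigma ::
    "'a set \<Rightarrow> 'a \<Rightarrow> nat \<Rightarrow> (nat \<Rightarrow> 'a set) \<Rightarrow> nat set \<Rightarrow> nat set" where
  "sigma E x r A I =
     I \<union> {k \<in> {1..r} - I. coloop (deletion (extension_matroid E x r A I) (A k)) x}"

definition closed_index_sets ::
    "'a set \<Rightarrow> 'a \<Rightarrow> nat \<Rightarrow> (nat \<Rightarrow> 'a set) \<Rightarrow> nat set set" where
  "closed_index_sets E x r A = {I. I \<subseteq> {1..r} \<and> sigma E x r A I = I}"

definition lattice_of_sets :: "'b set set \<Rightarrow> bool" where
  "lattice_of_sets L \<longleftrightarrow> L \<noteq> {} \<and> (\<forall>I\<in>L. \<forall>J\<in>L. I \<union> J \<in> L \<and> I \<inter> J \<in> L)"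

text \<open>Both lattices have union as join and intersection as meet, so a sublattice is a subset that
  is itself closed under these operations.\<close>

definition sublattice_of_sets :: "'b set set \<Rightarrow> 'b set set \<Rightarrow> bool" where
  "sublattice_of_sets K L \<longleftrightarrow> lattice_of_sets L \<and> K \<subseteq> L \<and> lattice_of_sets K"

end

theory Submission
  imports Defs
begin

text \<open>
  Call \<open>R \<subseteq> [r]\<close> tight if \<open>[r] - R\<close> can be matched into the elements lying in no \<open>A\<^sub>j\<close> with
  \<open>j \<in> R\<close>. Alternating paths show that \<open>I\<close> is closed iff \<open>[r] - I\<close> is a union of tight sets.
  Tight sets are closed under intersection, which makes the closed sets a lattice, and a set that is
  tight for \<open>\<B>\<close> is tight for the smaller presentation \<open>\<A>\<close>, so \<open>L\<^sub>\<B> \<subseteq> L\<^sub>\<A>\<close>.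

  For the equality of the extensions, take a basis of \<open>M[\<B>\<^sup>I]\<close> containing \<open>x\<close> and match it in
  \<open>\<B>\<^sup>I\<close> using as few edges outside \<open>\<A>\<^sup>I\<close> as possible. Let \<open>h\<close> be matched to \<open>c\<close> by such an edge
  and let \<open>S\<close> be the set of indices reached from \<open>h\<close> by \<open>\<A>\<^sup>I\<close>-alternating paths; by minimality \<open>c\<close>
  avoids \<open>A\<^sub>j\<close> for \<open>j \<in> S\<close>. A tight set \<open>R\<close> of \<open>\<B>\<close> around \<open>h\<close> then yields a set that is
  independent for \<open>\<B>\<close> but has \<open>r - |R \<inter> S| + 1\<close> elements, all avoiding \<open>A\<^sub>j\<close> for
  \<open>j \<in> R \<inter> S\<close>, so that it is dependent for \<open>\<A>\<close>.
\<close>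

subsection \<open>Matchings\<close>

lemma partial_transversal_image:
  assumes "D \<subseteq> {1..r}" "inj_on g D" "\<And>i. i \<in> D \<Longrightarrow> g i \<in> A i"
  shows "partial_transversal r A (g ` D)"
proof -
  have "inj_on (inv_into D g) (g ` D)"
    by (simp add: inj_on_inv_into)
  moreover have "inv_into D g e \<in> {1..r} \<and> e \<in> A (inv_into D g e)" if "e \<in> g ` D" for e
    using that assms inv_into_into[OF that] f_inv_into_f[OF that] by (metis subsetD)
  ultimately show ?thesis
    unfolding partial_transversal_def by blast
qed

lemma partial_transversalE:
  assumes "partial_transversal r A X"
  obtains D g where "D \<subseteq> {1..r}" "inj_on g D" "g ` D = X" "\<And>i. i \<in> D \<Longrightarrow> g i \<in> A i"
proof -
  obtain \<phi> where \<phi>: "inj_on \<phi> X" "\<forall>e\<in>X. \<phi> e \<in> {1..r} \<and> e \<in> A (\<phi> e)"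
    using assms unfolding partial_transversal_def by blast
  show thesis
  proof (rule that[of "\<phi> ` X" "inv_into X \<phi>"])
    show "\<phi> ` X \<subseteq> {1..r}" using \<phi> by blast
    show "inj_on (inv_into X \<phi>) (\<phi> ` X)" by (simp add: inj_on_inv_into)
    show "inv_into X \<phi> ` \<phi> ` X = X" using \<phi> by simp
    show "inv_into X \<phi> i \<in> A i" if "i \<in> \<phi> ` X" for i
      using that \<phi> by auto
  qed
qed

lemma partial_transversal_subset:
  "partial_transversal r A X \<Longrightarrow> Y \<subseteq> X \<Longrightarrow> partial_transversal r A Y"
  unfolding partial_transversal_def by (meson inj_on_subset subset_iff)

lemma partial_transversal_mono:
  assumes "partial_transversal r A X"
    and "\<And>i e. i \<in> {1..r} \<Longrightarrow> e \<in> X \<Longrightarrow> e \<in> A i \<Longrightarrow> e \<in> B i"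
  shows "partial_transversal r B X"
  using assms unfolding partial_transversal_def by metis

lemma partial_transversal_finite: "partial_transversal r A X \<Longrightarrow> finite X"
  by (metis finite_atLeastAtMost finite_imageI finite_subset partial_transversalE)

lemma partial_transversal_subset_ground:
  "set_system E r A \<Longrightarrow> partial_transversal r A X \<Longrightarrow> X \<subseteq> E"
  unfolding set_system_def partial_transversal_def by blast

text \<open>A matching of \<open>X\<close> can only use indices outside \<open>R\<close>. Dependence
  is always detected through this count.\<close>

lemma card_partial_transversal_avoiding:
  assumes "partial_transversal r A X" "R \<subseteq> {1..r}" "\<And>j. j \<in> R \<Longrightarrow> X \<inter> A j = {}"
  shows "card X + card R \<le> r"
proof -
  obtain D g where D: "D \<subseteq> {1..r}" "inj_on g D" "g ` D = X" "\<And>i. i \<in> D \<Longrightarrow> g i \<in> A i"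
    using partial_transversalE[OF assms(1)] by blast
  have "D \<inter> R = {}"
    using D(3,4) assms(3) by blast
  then have "card D + card R = card (D \<union> R)"
    by (metis D(1) assms(2) card_Un_disjoint finite_atLeastAtMost finite_subset)
  also have "\<dots> \<le> r"
    using card_mono[of "{1..r}" "D \<union> R"] D(1) assms(2) by simp
  finally show ?thesis
    using D(2,3) card_image by fastforce
qed

text \<open>This takes the place of augmenting an independent set to a basis: \<open>m\<close>
  supplies the missing elements, and the resulting matching leaves no index free.\<close>

lemma extend_to_full_matching:
  assumes X: "partial_transversal r A X"
    and m: "inj_on m {1..r}" "\<forall>i\<in>{1..r}. m i \<in> A i"
  obtains g where "inj_on g {1..r}" "\<And>i. i \<in> {1..r} \<Longrightarrow> g i \<in> A i"
    "X \<subseteq> g ` {1..r}" "g ` {1..r} \<subseteq> X \<union> m ` {1..r}"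
proof -
  define P where "P = (\<lambda>(D, g). D \<subseteq> {1..r} \<and> inj_on g D \<and> (\<forall>i\<in>D. g i \<in> A i)
      \<and> X \<subseteq> g ` D \<and> g ` D \<subseteq> X \<union> m ` {1..r})"
  \<comment> \<open>A matching that agrees with \<open>m\<close> as often as possible is already full.\<close>
  define agree where "agree = (\<lambda>(D, g). card {i \<in> D. g i = m i})"
  obtain D0 g0 where "D0 \<subseteq> {1..r}" "inj_on g0 D0" "g0 ` D0 = X" "\<And>i. i \<in> D0 \<Longrightarrow> g0 i \<in> A i"
    using partial_transversalE[OF X] by blast
  then have 0: "P (D0, g0)" unfolding P_def by simp
  have bound: "\<forall>p. P p \<longrightarrow> agree p < Suc r"
  proof (intro allI impI)
    fix p assume "P p"
    moreover obtain D g where "p = (D, g)" by fastforce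
    moreover from calculation have "{i \<in> D. g i = m i} \<subseteq> {1..r}"
      unfolding P_def by auto
    ultimately show "agree p < Suc r"
      using card_mono[of "{1..r}" "{i \<in> D. g i = m i}"]
      unfolding agree_def by simp
  qed
  obtain D g where Dg: "P (D, g)" and max: "\<And>D' g'. P (D', g') \<Longrightarrow> agree (D', g') \<le> agree (D, g)"
    using ex_has_greatest_nat[OF 0 bound] by (auto simp del: split_paired_All)
  have D: "D \<subseteq> {1..r}" "inj_on g D" "\<forall>i\<in>D. g i \<in> A i" "X \<subseteq> g ` D" "g ` D \<subseteq> X \<union> m ` {1..r}"
    using Dg unfolding P_def by auto
  have fin: "finite D" using D(1) finite_subset by blast
  have "k \<in> D" if k: "k \<in> {1..r}" for k
  proof (rule ccontr)
    assume kD: "k \<notin> D"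
    \<comment> \<open>\<open>J\<close> has at most one member, the index that holds
      \<open>m k\<close>. Evicting it loses no element of the image, because \<open>k\<close> now
      carries \<open>m k\<close>.\<close>
    define J where "J = {j \<in> D. g j = m k}"
    define D' where "D' = insert k (D - J)"
    define g' where "g' = g(k := m k)"
    have img: "g' ` D' = insert (m k) (g ` D)"
      unfolding D'_def g'_def J_def using kD by auto
    have "inj_on g' D'"
      unfolding D'_def g'_def J_def using D(2) kD by (auto simp: inj_on_def)
    moreover have "D' \<subseteq> {1..r}" unfolding D'_def using D(1) k by auto
    moreover have "\<forall>i\<in>D'. g' i \<in> A i"
      unfolding D'_def g'_def using D(3) bspec[OF m(2) k] by auto
    moreover have "X \<subseteq> g' ` D'" "g' ` D' \<subseteq> X \<union> m ` {1..r}"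
      unfolding img using D(4,5) k by auto
    ultimately have "P (D', g')" unfolding P_def case_prod_conv by (intro conjI)
    moreover have "{i \<in> D. g i = m i} \<subset> {i \<in> D'. g' i = m i}"
    proof -
      \<comment> \<open>An evicted index did not agree with \<open>m\<close>, since \<open>m\<close>
        is injective and already takes this value at \<open>k\<close>. So agreements survive and
        \<open>k\<close> is a new one.\<close>
      have "i \<notin> J" if "i \<in> D" "g i = m i" for i
      proof
        assume "i \<in> J"
        then have "m i = m k" using that(2) unfolding J_def by simp
        then have "i = k" using inj_onD[OF m(1)] that(1) k D(1) by blast
        then show False using that(1) kD by simp
      qed
      then show ?thesis
        unfolding D'_def g'_def using kD by auto
    qed
    then have "agree (D, g) < agree (D', g')"
      unfolding agree_def using fin by (auto intro!: psubset_card_mono simp: D'_def)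
    ultimately show False using max by fastforce
  qed
  then have "D = {1..r}" using D(1) by blast
  then show thesis using D that by blast
qed

text \<open>\<open>S\<close> consists of the indices reached from \<open>h\<close> by alternating paths; it is obtained as a maximal
  set to whose members the hole at \<open>h\<close> can be moved by changes inside the set.\<close>

lemma alternating_set:
  fixes g :: "'i \<Rightarrow> 'a" and A :: "'i \<Rightarrow> 'a set"
  assumes fin: "finite T" and h: "h \<in> T" and inj: "inj_on g (T - {h})"
  obtains S where "S \<subseteq> T" "h \<in> S"
    "\<And>j l. j \<in> S \<Longrightarrow> l \<in> T - S \<Longrightarrow> g l \<notin> A j"
    "\<And>j. j \<in> S \<Longrightarrow> \<exists>g'. inj_on g' (T - {j}) \<and> g' ` (T - {j}) = g ` (T - {h})
        \<and> (\<forall>i\<in>T - {j}. (i \<noteq> h \<and> g' i = g i) \<or> g' i \<in> A i)"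
proof -
  \<comment> \<open>\<open>g'\<close> is a matching whose hole has moved from \<open>h\<close> to
    \<open>j\<close>. Index \<open>h\<close> starts empty, so whatever it receives must be a genuine
    edge. The last clause freezes indices outside \<open>S\<close>, so that they still carry their
    original elements when \<open>S\<close> grows.\<close>
  define Q where "Q = (\<lambda>S j g'. inj_on g' (T - {j}) \<and> g' ` (T - {j}) = g ` (T - {h})
        \<and> (\<forall>i\<in>T - {j}. (i \<noteq> h \<and> g' i = g i) \<or> g' i \<in> A i) \<and> (\<forall>i\<in>T - S. g' i = g i))"
  define F where "F = {S. S \<subseteq> T \<and> h \<in> S \<and> (\<forall>j\<in>S. \<exists>g'. Q S j g')}"
  have "Q {h} h g" unfolding Q_def using inj by auto
  then have "{h} \<in> F" unfolding F_def using h by auto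
  moreover have "finite F" unfolding F_def using fin by auto
  ultimately obtain S where S: "S \<in> F" and max: "\<And>S'. S' \<in> F \<Longrightarrow> S \<subseteq> S' \<Longrightarrow> S' = S"
    using finite_has_maximal2[of F "{h}"] by metis
  have ST: "S \<subseteq> T" "h \<in> S" "\<And>j. j \<in> S \<Longrightarrow> \<exists>g'. Q S j g'"
    using S unfolding F_def by auto
  have closed: "g l \<notin> A j" if j: "j \<in> S" and l: "l \<in> T - S" for j l
  proof
    assume glj: "g l \<in> A j"
    obtain g' where g': "Q S j g'" using ST(3) j by blast
    have g'l: "g' l = g l" and lj: "l \<noteq> j" "l \<noteq> h" "j \<in> T" using g' l j ST unfolding Q_def by auto
    have "\<exists>g'. Q (insert l S) i g'" if "i \<in> S" for i
    proof -
      obtain u where "Q S i u" using ST(3) \<open>i \<in> S\<close> by blast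
      then have "Q (insert l S) i u" unfolding Q_def by simp
      then show ?thesis by blast
    qed
    \<comment> \<open>The element \<open>g l\<close> slides from \<open>l\<close> into the hole at
      \<open>j\<close>, and the hole moves on to \<open>l\<close>.\<close>
    moreover have "Q (insert l S) l (g'(j := g l))"
    proof -
      have i: "inj_on g' (T - {j})" and im: "g' ` (T - {j}) = g ` (T - {h})"
        using g' unfolding Q_def by auto
      have "inj_on (g'(j := g l)) (T - {l})"
      proof (rule inj_onI)
        fix a b assume "a \<in> T - {l}" "b \<in> T - {l}" "(g'(j := g l)) a = (g'(j := g l)) b"
        then show "a = b"
          using i g'l lj(1) l inj_onD[OF i, of a l] inj_onD[OF i, of l b] inj_onD[OF i, of a b]
          by (cases "a = j"; cases "b = j") auto
      qed
      moreover have "(g'(j := g l)) ` (T - {l}) = g' ` (T - {j})"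
      proof -
        have "T - {l} = insert j (T - {j, l})" "T - {j} = insert l (T - {j, l})"
          using lj l by auto
        then have "(g'(j := g l)) ` (T - {l}) = insert (g l) (g' ` (T - {j, l}))"
          "g' ` (T - {j}) = insert (g l) (g' ` (T - {j, l}))"
          using g'l by auto
        then show ?thesis by simp
      qed
      ultimately show ?thesis
        using g' glj j im unfolding Q_def by auto
    qed
    ultimately have "insert l S \<in> F" unfolding F_def using ST l by blast
    then show False using max l by blast
  qed
  show thesis
    by (rule that[OF ST(1,2) closed], assumption+, drule ST(3), unfold Q_def, elim exE conjE,
        intro exI conjI, assumption+)
qed

subsection \<open>Tight index sets\<close>

text \<open>In terms of rank: the elements lying in no \<open>A j\<close> with \<open>j\<close> in
  \<open>R\<close> contain an independent set of size \<open>r - card R\<close>, the largest size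
  that counting allows.\<close>

definition tight_set :: "nat \<Rightarrow> (nat \<Rightarrow> 'a set) \<Rightarrow> nat set \<Rightarrow> bool" where
  "tight_set r A R \<longleftrightarrow> R \<subseteq> {1..r} \<and>
     (\<exists>f. inj_on f ({1..r} - R) \<and> (\<forall>i\<in>{1..r} - R. f i \<in> A i \<and> (\<forall>j\<in>R. f i \<notin> A j)))"

lemma tight_set_full: "tight_set r A {1..r}"
  unfolding tight_set_def by auto

text \<open>Use \<open>g\<close> on \<open>R\<close> and \<open>f\<close> off \<open>R\<close>. No
  collision occurs, because \<open>f\<close> avoids \<open>A i\<close> for every \<open>i\<close> in
  \<open>R\<close>, whereas \<open>g i\<close> lies in \<open>A i\<close>.\<close>

lemma tight_set_Int:
  assumes "tight_set r A R" "tight_set r A Q"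
  shows "tight_set r A (R \<inter> Q)"
proof -
  obtain f where f: "R \<subseteq> {1..r}" "inj_on f ({1..r} - R)"
    "\<forall>i\<in>{1..r} - R. f i \<in> A i \<and> (\<forall>j\<in>R. f i \<notin> A j)"
    using assms(1) unfolding tight_set_def by blast
  obtain g where g: "inj_on g ({1..r} - Q)"
    "\<forall>i\<in>{1..r} - Q. g i \<in> A i \<and> (\<forall>j\<in>Q. g i \<notin> A j)"
    using assms(2) unfolding tight_set_def by blast
  define k where "k = (\<lambda>i. if i \<in> R then g i else f i)"
  have "inj_on k ({1..r} - R \<inter> Q)"
  proof (rule inj_onI)
    fix a b assume ab: "a \<in> {1..r} - R \<inter> Q" "b \<in> {1..r} - R \<inter> Q" "k a = k b"
    have "a \<in> R \<longleftrightarrow> b \<in> R"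
      using ab f(3) g(2) unfolding k_def by (metis Diff_iff Int_iff)
    then show "a = b"
      using ab inj_onD[OF f(2), of a b] inj_onD[OF g(1), of a b] unfolding k_def
      by (cases "a \<in> R") simp_all
  qed
  moreover have "\<forall>i\<in>{1..r} - R \<inter> Q. k i \<in> A i \<and> (\<forall>j\<in>R \<inter> Q. k i \<notin> A j)"
    using f(3) g(2) unfolding k_def by auto
  ultimately show ?thesis
    unfolding tight_set_def using f(1) by blast
qed

text \<open>The image of \<open>f\<close> avoids even more when the sets shrink, and it stays
  independent. Having \<open>r - card R\<close> elements, it can be matched in \<open>A\<close> only
  by using every index outside \<open>R\<close>.\<close>

lemma tight_set_antimono:
  assumes R: "tight_set r B R"
    and le: "system_le r A B"
    and BA: "\<And>X. partial_transversal r B X \<Longrightarrow> partial_transversal r A X"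
  shows "tight_set r A R"
proof -
  obtain f where f: "R \<subseteq> {1..r}" "inj_on f ({1..r} - R)"
    "\<forall>i\<in>{1..r} - R. f i \<in> B i \<and> (\<forall>j\<in>R. f i \<notin> B j)"
    using R unfolding tight_set_def by blast
  define W where "W = f ` ({1..r} - R)"
  have avoid: "e \<notin> A j" if "e \<in> W" "j \<in> R" for e j
    using that f le unfolding W_def system_le_def by blast
  have "partial_transversal r B W"
    unfolding W_def using f by (intro partial_transversal_image) auto
  then obtain D g where D: "D \<subseteq> {1..r}" "inj_on g D" "g ` D = W" "\<And>i. i \<in> D \<Longrightarrow> g i \<in> A i"
    using partial_transversalE[OF BA] by metis
  have "D \<subseteq> {1..r} - R" using D avoid by blast
  moreover have "card D = card ({1..r} - R)"
    using card_image[OF D(2)] card_image[OF f(2)] D(3) unfolding W_def by simp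
  ultimately have DR: "D = {1..r} - R" by (simp add: card_subset_eq)
  have "\<forall>i\<in>D. g i \<in> A i \<and> (\<forall>j\<in>R. g i \<notin> A j)"
    using D(3,4) avoid by blast
  then show ?thesis
    unfolding tight_set_def using f(1) D(2) unfolding DR by blast
qed

subsection \<open>Closed index sets\<close>

lemma partial_transversal_extend_system:
  "x \<notin> X \<Longrightarrow> partial_transversal r (extend_system x A I) X \<longleftrightarrow> partial_transversal r A X"
  by (auto elim!: partial_transversal_mono simp: extend_system_def split: if_splits)

text \<open>Translates coloops into matchings. An independent set that avoids \<open>A k\<close> and
  \<open>x\<close> lies in a maximal one, which contains a coloop \<open>x\<close>; conversely, a
  maximal set without \<open>x\<close> could be enlarged by \<open>x\<close>.\<close>

lemma coloop_extension_iff: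
  assumes ss: "set_system E r A" and x: "x \<notin> E" and k: "k \<in> {1..r}"
  shows "coloop (deletion (extension_matroid E x r A I) (A k)) x \<longleftrightarrow>
    (\<forall>X. X \<inter> A k = {} \<and> partial_transversal r A X \<longrightarrow>
       partial_transversal r (extend_system x A I) (insert x X))"
proof -
  let ?A = "extend_system x A I"
  let ?Ind = "{X. X \<subseteq> insert x E - A k \<and> partial_transversal r ?A X}"
  have xk: "x \<notin> A k" using ss x k unfolding set_system_def by blast
  have "finite E" using ss unfolding set_system_def by blast
  then have fin: "finite ?Ind" by auto
  let ?N = "deletion (extension_matroid E x r A I) (A k)"
  have gr: "ground ?N = insert x E - A k"
    unfolding deletion_def extension_matroid_def transversal_matroid_of_def by simp
  have ind: "indeps ?N = ?Ind"
    unfolding deletion_def extension_matroid_def transversal_matroid_of_def by auto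
  have col: "coloop ?N x \<longleftrightarrow> (\<forall>B\<in>?Ind. (\<forall>X\<in>?Ind. B \<subseteq> X \<longrightarrow> X = B) \<longrightarrow> x \<in> B)"
    (is "_ \<longleftrightarrow> ?max")
    unfolding coloop_def bases_def gr ind using xk by blast
  show ?thesis
    unfolding col
  proof (intro iffI allI impI ballI)
    fix X assume max: ?max and X: "X \<inter> A k = {} \<and> partial_transversal r A X"
    have XE: "X \<subseteq> E" using X ss partial_transversal_subset_ground by blast
    then have "partial_transversal r ?A X"
      using X x partial_transversal_extend_system by (metis subsetD)
    then have "X \<in> ?Ind" using X XE by blast
    from finite_has_maximal2[OF fin this]
    obtain B where B: "B \<in> ?Ind" "X \<subseteq> B" "\<forall>Y\<in>?Ind. B \<subseteq> Y \<longrightarrow> B = Y" by (elim bexE conjE)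
    have "\<forall>Y\<in>?Ind. B \<subseteq> Y \<longrightarrow> Y = B" by (intro ballI impI, rule sym, rule B(3)[rule_format])
    then have "x \<in> B" using bspec[OF max B(1)] by (rule rev_mp)
    then show "partial_transversal r ?A (insert x X)"
      using B(1,2) partial_transversal_subset[of r ?A B "insert x X"] by blast
  next
    fix B assume all: "\<forall>X. X \<inter> A k = {} \<and> partial_transversal r A X \<longrightarrow>
       partial_transversal r ?A (insert x X)"
      and B: "B \<in> ?Ind" "\<forall>X\<in>?Ind. B \<subseteq> X \<longrightarrow> X = B"
    show "x \<in> B"
    proof (rule ccontr)
      assume nx: "x \<notin> B"
      have BE: "B \<subseteq> insert x E - A k" "partial_transversal r ?A B" using B(1) by simp_all
      have "partial_transversal r A B" using partial_transversal_extend_system[OF nx] BE(2) by simp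
      moreover have "B \<inter> A k = {}" using BE(1) by blast
      ultimately have "partial_transversal r ?A (insert x B)" using all by simp
      then have "insert x B \<in> ?Ind" using BE(1) xk by simp
      from bspec[OF B(2) this] show False using nx by blast
    qed
  qed
qed

text \<open>For \<open>k\<close> outside \<open>I\<close>, a tight set around \<open>k\<close> that
  misses \<open>I\<close> is exactly an obstruction to \<open>x\<close> being a coloop once
  \<open>A k\<close> is deleted.\<close>

lemma closed_index_sets_iff:
  assumes ss: "set_system E r A" and x: "x \<notin> E"
    and m: "inj_on m {1..r}" "\<forall>i\<in>{1..r}. m i \<in> A i"
  shows "I \<in> closed_index_sets E x r A \<longleftrightarrow>
    I \<subseteq> {1..r} \<and> (\<forall>k\<in>{1..r} - I. \<exists>R. tight_set r A R \<and> k \<in> R \<and> R \<inter> I = {})"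
proof -
  let ?A = "extend_system x A I"
  have xA: "x \<notin> A i" if "i \<in> {1..r}" for i
    using ss x that unfolding set_system_def by blast
  have "(\<not> coloop (deletion (extension_matroid E x r A I) (A k)) x) \<longleftrightarrow>
      (\<exists>R. tight_set r A R \<and> k \<in> R \<and> R \<inter> I = {})"
    if I: "I \<subseteq> {1..r}" and k: "k \<in> {1..r} - I" for k
  proof
    assume "\<not> coloop (deletion (extension_matroid E x r A I) (A k)) x"
    then obtain X where X: "X \<inter> A k = {}" "partial_transversal r A X"
      and dep: "\<not> partial_transversal r ?A (insert x X)"
      using coloop_extension_iff[OF ss x] k by blast
    obtain g where g: "inj_on g {1..r}" "\<And>i. i \<in> {1..r} \<Longrightarrow> g i \<in> A i" "X \<subseteq> g ` {1..r}"
      using extend_to_full_matching[OF X(2) m] by metis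
    \<comment> \<open>Since \<open>X\<close> avoids \<open>A k\<close>, index \<open>k\<close> can
      be vacated without uncovering \<open>X\<close>; it becomes the hole.\<close>
    have Xk: "X \<subseteq> g ` ({1..r} - {k})" using g X(1) by blast
    have "inj_on g ({1..r} - {k})" using g(1) inj_on_subset by blast
    then obtain S where S: "S \<subseteq> {1..r}" "k \<in> S"
      "\<And>j l. j \<in> S \<Longrightarrow> l \<in> {1..r} - S \<Longrightarrow> g l \<notin> A j"
      "\<And>j. j \<in> S \<Longrightarrow> \<exists>g'. inj_on g' ({1..r} - {j}) \<and> g' ` ({1..r} - {j}) = g ` ({1..r} - {k})
        \<and> (\<forall>i\<in>{1..r} - {j}. (i \<noteq> k \<and> g' i = g i) \<or> g' i \<in> A i)"
      using alternating_set[of "{1..r}" k g A] k by (metis DiffD1 finite_atLeastAtMost)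
    \<comment> \<open>Otherwise the hole could be moved to \<open>j\<close> and filled with
      \<open>x\<close>, matching \<open>insert x X\<close>.\<close>
    have "j \<notin> I" if j: "j \<in> S" for j
    proof
      assume jI: "j \<in> I"
      obtain g' where g': "inj_on g' ({1..r} - {j})" "g' ` ({1..r} - {j}) = g ` ({1..r} - {k})"
        "\<forall>i\<in>{1..r} - {j}. (i \<noteq> k \<and> g' i = g i) \<or> g' i \<in> A i"
        using S(4)[OF j] by blast
      have g'A: "\<forall>i\<in>{1..r} - {j}. g' i \<in> A i" using g'(3) g(2) by (metis DiffD1)
      define u where "u = g'(j := x)"
      have jr: "j \<in> {1..r}" using j S(1) by blast
      have xg: "x \<notin> g' ` ({1..r} - {j})" using g'A xA by blast
      have "inj_on u ({1..r} - {j})"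
        unfolding u_def using inj_on_fun_updI[OF g'(1) xg] .
      moreover have "u j \<notin> u ` ({1..r} - {j} - {j})"
        unfolding u_def using xg by simp
      ultimately have "inj_on u {1..r}"
        using inj_on_insert[of u j "{1..r} - {j}"] insert_Diff[OF jr] by simp
      moreover have "u i \<in> ?A i" if "i \<in> {1..r}" for i
        using that g'A jI unfolding u_def extend_system_def by auto
      ultimately have "partial_transversal r ?A (u ` {1..r})"
        by (intro partial_transversal_image) auto
      moreover have "insert x X \<subseteq> u ` {1..r}"
      proof -
        have "u ` {1..r} = insert x (g' ` ({1..r} - {j}))"
          unfolding u_def using jr by auto
        then show ?thesis unfolding g'(2) using insert_mono[OF Xk, of x] by simp
      qed
      ultimately show False using dep partial_transversal_subset by blast
    qed
    \<comment> \<open>The matching \<open>g\<close> itself is the witness: no alternating path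
      leaves \<open>S\<close>, so elements matched outside \<open>S\<close> avoid \<open>A j\<close>
      for all \<open>j\<close> in \<open>S\<close>.\<close>
    moreover have "tight_set r A S"
      unfolding tight_set_def
    proof (intro conjI exI)
      show "inj_on g ({1..r} - S)" using g(1) inj_on_subset by blast
    qed (use S g in auto)
    ultimately show "\<exists>R. tight_set r A R \<and> k \<in> R \<and> R \<inter> I = {}" using S(2) by blast
  next
    assume "\<exists>R. tight_set r A R \<and> k \<in> R \<and> R \<inter> I = {}"
    then obtain R f where R: "R \<subseteq> {1..r}" "k \<in> R" "R \<inter> I = {}" "inj_on f ({1..r} - R)"
      "\<forall>i\<in>{1..r} - R. f i \<in> A i \<and> (\<forall>j\<in>R. f i \<notin> A j)"
      unfolding tight_set_def by blast
    \<comment> \<open>\<open>X\<close> already has the maximal size for a set avoiding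
      \<open>R\<close>. As \<open>R\<close> misses \<open>I\<close>, adding \<open>x\<close> still
      avoids \<open>R\<close> and exceeds the count.\<close>
    define X where "X = f ` ({1..r} - R)"
    have X: "partial_transversal r A X"
      unfolding X_def using R by (intro partial_transversal_image) auto
    have "\<not> partial_transversal r ?A (insert x X)"
    proof
      assume "partial_transversal r ?A (insert x X)"
      moreover have "insert x X \<inter> ?A j = {}" if "j \<in> R" for j
        using that R xA unfolding extend_system_def X_def by auto
      ultimately have "card (insert x X) + card R \<le> r"
        using card_partial_transversal_avoiding R(1) by blast
      moreover have "x \<notin> X" using R(5) xA unfolding X_def by blast
      moreover have "card X = r - card R"
        unfolding X_def using R(1,4) by (simp add: card_image card_Diff_subset finite_subset)
      moreover have "card R \<le> r" using R(1) card_mono[of "{1..r}" R] by simp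
      ultimately show False
        using partial_transversal_finite[OF X] by simp
    qed
    moreover have "X \<inter> A k = {}" unfolding X_def using R by blast
    ultimately show "\<not> coloop (deletion (extension_matroid E x r A I) (A k)) x"
      using coloop_extension_iff[OF ss x] k X by blast
  qed
  then show ?thesis
    unfolding closed_index_sets_def sigma_def by blast
qed

text \<open>For a union, intersect the two tight sets around \<open>k\<close>; for an intersection,
  the tight set from either side suffices.\<close>

lemma lattice_of_closed_index_sets:
  assumes "set_system E r A" "x \<notin> E"
    and "inj_on m {1..r}" "\<forall>i\<in>{1..r}. m i \<in> A i"
  shows "lattice_of_sets (closed_index_sets E x r A)"
proof -
  note iff = closed_index_sets_iff[OF assms]
  have "{1..r} \<in> closed_index_sets E x r A" unfolding iff by simp
  moreover have "I \<union> J \<in> closed_index_sets E x r A"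
    if IJ: "I \<in> closed_index_sets E x r A" "J \<in> closed_index_sets E x r A" for I J
    unfolding iff
  proof (intro conjI ballI)
    show "I \<union> J \<subseteq> {1..r}" using IJ unfolding iff by blast
    fix k assume k: "k \<in> {1..r} - (I \<union> J)"
    obtain R where "tight_set r A R" "k \<in> R" "R \<inter> I = {}"
      using IJ(1) k unfolding iff by blast
    moreover obtain Q where "tight_set r A Q" "k \<in> Q" "Q \<inter> J = {}"
      using IJ(2) k unfolding iff by blast
    ultimately show "\<exists>R. tight_set r A R \<and> k \<in> R \<and> R \<inter> (I \<union> J) = {}"
      using tight_set_Int by (intro exI[of _ "R \<inter> Q"]) blast
  qed
  moreover have "I \<inter> J \<in> closed_index_sets E x r A"
    if IJ: "I \<in> closed_index_sets E x r A" "J \<in> closed_index_sets E x r A" for I J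
    unfolding iff
  proof (intro conjI ballI)
    show "I \<inter> J \<subseteq> {1..r}" using IJ unfolding iff by blast
    fix k assume "k \<in> {1..r} - I \<inter> J"
    then consider "k \<in> {1..r} - I" | "k \<in> {1..r} - J" by blast
    then obtain R where "tight_set r A R" "k \<in> R" "R \<inter> I = {} \<or> R \<inter> J = {}"
      by cases (use IJ[unfolded iff] in blast)+
    then show "\<exists>R. tight_set r A R \<and> k \<in> R \<and> R \<inter> (I \<inter> J) = {}" by blast
  qed
  ultimately show ?thesis unfolding lattice_of_sets_def by blast
qed

subsection \<open>Comparing the extensions\<close>

text \<open>This is the inclusion of independent sets that rests on \<open>I\<close> being closed
  for \<open>B\<close>; the reverse one is monotonicity. The set \<open>X\<close> is arbitrary and
  is first covered by a full matching.\<close>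

lemma extension_partial_transversal:
  assumes ssB: "set_system E r B" and x: "x \<notin> E"
    and m: "inj_on m {1..r}" "\<forall>i\<in>{1..r}. m i \<in> B i"
    and le: "system_le r A B"
    and BA: "\<And>X. partial_transversal r B X \<Longrightarrow> partial_transversal r A X"
    and I: "I \<in> closed_index_sets E x r B"
    and X: "partial_transversal r (extend_system x B I) X"
  shows "partial_transversal r (extend_system x A I) X"
proof -
  let ?A = "extend_system x A I" and ?B = "extend_system x B I" and ?T = "{1..r}"
  have xB: "x \<notin> B i" if "i \<in> ?T" for i
    using ssB x that unfolding set_system_def by blast
  have AB: "?A i \<subseteq> ?B i" if "i \<in> ?T" for i
    using le that unfolding system_le_def extend_system_def by auto
  define P where "P = (\<lambda>g. inj_on g ?T \<and> (\<forall>i\<in>?T. g i \<in> ?B i) \<and> X \<subseteq> g ` ?T)"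
  define bad where "bad = (\<lambda>g. {i \<in> ?T. g i \<notin> ?A i})"
  have "\<forall>i\<in>?T. m i \<in> ?B i"
    using m(2) unfolding extend_system_def by auto
  then obtain g0 where "P g0"
    using extend_to_full_matching[OF X m(1)] unfolding P_def by metis
  then obtain g where Pg: "P g" and min: "\<And>g'. P g' \<Longrightarrow> card (bad g) \<le> card (bad g')"
    using ex_has_least_nat[of P g0 "\<lambda>g. card (bad g)"] by blast
  have g: "inj_on g ?T" "\<And>i. i \<in> ?T \<Longrightarrow> g i \<in> ?B i" "X \<subseteq> g ` ?T"
    using Pg unfolding P_def by auto
  have "bad g = {}"
  proof (rule ccontr)
    assume "bad g \<noteq> {}"
    then obtain h where h: "h \<in> ?T" "g h \<notin> ?A h" unfolding bad_def by blast
    \<comment> \<open>Both systems receive \<open>x\<close> at the same indices, so an edge carrying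
      \<open>x\<close> is never bad.\<close>
    have ghx: "g h \<noteq> x"
      using h g(2)[OF h(1)] xB[OF h(1)] unfolding extend_system_def by (auto split: if_splits)
    have "inj_on g (?T - {h})" using g(1) inj_on_subset by blast
    then obtain S where S: "S \<subseteq> ?T" "h \<in> S"
      "\<And>j l. j \<in> S \<Longrightarrow> l \<in> ?T - S \<Longrightarrow> g l \<notin> ?A j"
      "\<And>j. j \<in> S \<Longrightarrow> \<exists>g'. inj_on g' (?T - {j}) \<and> g' ` (?T - {j}) = g ` (?T - {h})
        \<and> (\<forall>i\<in>?T - {j}. (i \<noteq> h \<and> g' i = g i) \<or> g' i \<in> ?A i)"
      using alternating_set[of ?T h g ?A] h(1) by (metis finite_atLeastAtMost)
    \<comment> \<open>Otherwise move the hole to \<open>j\<close> and put \<open>g h\<close> there.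
      The image is unchanged, \<open>h\<close> is no longer bad and no new bad index arises, against
      minimality.\<close>
    have cS: "g h \<notin> ?A j" if j: "j \<in> S" for j
    proof
      assume cj: "g h \<in> ?A j"
      have jT: "j \<in> ?T" using j S(1) by blast
      obtain g' where g': "inj_on g' (?T - {j})" "g' ` (?T - {j}) = g ` (?T - {h})"
        "\<forall>i\<in>?T - {j}. (i \<noteq> h \<and> g' i = g i) \<or> g' i \<in> ?A i"
        using S(4)[OF j] by blast
      define u where "u = g'(j := g h)"
      have img: "u ` ?T = g ` ?T"
      proof -
        have "u ` ?T = insert (g h) (g' ` (?T - {j}))" unfolding u_def using jT by auto
        also have "\<dots> = g ` (insert h (?T - {h}))" unfolding g'(2) image_insert ..
        finally show ?thesis unfolding insert_Diff[OF h(1)] .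
      qed
      then have "inj_on u ?T"
        using g(1) by (metis card_image eq_card_imp_inj_on finite_atLeastAtMost)
      moreover have "\<forall>i\<in>?T. u i \<in> ?B i"
      proof
        fix i assume i: "i \<in> ?T"
        have "u i \<in> ?A i \<or> u i = g i"
          using bspec[OF g'(3), of i] cj i unfolding u_def by (cases "i = j") auto
        then show "u i \<in> ?B i" using AB[OF i] g(2)[OF i] by auto
      qed
      moreover have "X \<subseteq> u ` ?T" unfolding img by (rule g(3))
      ultimately have "P u" unfolding P_def by (intro conjI)
      moreover have "bad u \<subset> bad g"
      proof -
        have "h \<notin> bad u"
          using bspec[OF g'(3), of h] cj h(1) unfolding bad_def u_def by (cases "h = j") auto
        moreover have "i \<in> bad g" if "i \<in> bad u" for i
          using bspec[OF g'(3), of i] cj that unfolding bad_def u_def by (cases "i = j") auto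
        then have "bad u \<subseteq> bad g" by blast
        ultimately show ?thesis using h unfolding bad_def by blast
      qed
      then have "card (bad u) < card (bad g)"
        by (intro psubset_card_mono) (auto simp: bad_def)
      ultimately show False using min by fastforce
    qed
    \<comment> \<open>On \<open>R - S\<close> the values of \<open>g\<close> must lie in
      \<open>B\<close> itself, hence differ from \<open>x\<close>. If \<open>h\<close> is in
      \<open>I\<close>, then \<open>x\<close> lies in \<open>?A h\<close>, so only an index in
      \<open>S\<close> can carry \<open>x\<close> and the full index set serves. Otherwise
      closedness of \<open>I\<close> gives an \<open>R\<close> missing \<open>I\<close>, where
      \<open>x\<close> cannot occur.\<close>
    have "\<exists>R. tight_set r B R \<and> h \<in> R \<and> (\<forall>j\<in>R - S. g j \<noteq> x)"
    proof (cases "h \<in> I")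
      case True
      then have "x \<in> ?A h" unfolding extend_system_def by auto
      then have "g j \<noteq> x" if "j \<in> ?T - S" for j
        using S(3)[OF S(2) that] by metis
      then show ?thesis
        using h(1) tight_set_full by blast
    next
      case False
      then obtain R where R: "tight_set r B R" "h \<in> R" "R \<inter> I = {}"
        using I h(1) unfolding closed_index_sets_iff[OF ssB x m] by blast
      have "g j \<noteq> x" if "j \<in> R" for j
      proof -
        have "j \<in> ?T" "j \<notin> I" using R that unfolding tight_set_def by auto
        then show ?thesis using g(2)[of j] xB[of j] unfolding extend_system_def by auto
      qed
      then show ?thesis using R by blast
    qed
    then obtain R f where R: "R \<subseteq> ?T" "h \<in> R" "\<forall>j\<in>R - S. g j \<noteq> x" "inj_on f (?T - R)"
      "\<forall>i\<in>?T - R. f i \<in> B i \<and> (\<forall>j\<in>R. f i \<notin> B j)"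
      unfolding tight_set_def by blast
    \<comment> \<open>As \<open>h\<close> lies in \<open>R\<close> and \<open>S\<close>, adding it
      makes \<open>D\<close> one larger than the complement of \<open>R \<inter> S\<close>. The map
      \<open>k\<close> then matches one element too many.\<close>
    define D where "D = insert h (?T - R \<inter> S)"
    define k where "k = (\<lambda>i. if i \<in> R then g i else f i)"
    have gB: "g i \<in> B i" if "i \<in> D" "i \<in> R" for i
    proof -
      have "g i \<noteq> x" using that R(3) ghx unfolding D_def by auto
      moreover have "i \<in> ?T" using that R(1) by blast
      ultimately show ?thesis using g(2)[of i] unfolding extend_system_def by (auto split: if_splits)
    qed
    have DT: "D \<subseteq> ?T" unfolding D_def using h by auto
    have kB: "k i \<in> B i" if "i \<in> D" for i
      using that gB R(5) DT unfolding k_def by auto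
    have injk: "inj_on k D"
    proof (rule inj_onI)
      fix a b assume ab: "a \<in> D" "b \<in> D" "k a = k b"
      then have T: "a \<in> ?T" "b \<in> ?T" using DT by auto
      have "a \<in> R \<longleftrightarrow> b \<in> R"
        using ab T gB R(5) unfolding k_def by (metis Diff_iff)
      then show "a = b"
        using ab T inj_onD[OF g(1), of a b] inj_onD[OF R(4), of a b] unfolding k_def
        by (cases "a \<in> R") simp_all
    qed
    have "partial_transversal r A (k ` D)"
      using BA partial_transversal_image[OF DT injk] kB by blast
    \<comment> \<open>Three sources of avoidance: \<open>cS\<close> for \<open>g h\<close>, the
      closure of \<open>S\<close> for \<open>g\<close> on \<open>R - S\<close>, and tightness of
      \<open>R\<close> with \<open>system_le r A B\<close> for \<open>f\<close>.\<close>
    moreover have "k ` D \<inter> A j = {}" if j: "j \<in> R \<inter> S" for j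
    proof -
      have "k i \<notin> A j" if i: "i \<in> D" for i
      proof (cases "i \<in> R")
        case True
        have "g i \<notin> ?A j"
          using i True j S(3) cS R(1) unfolding D_def by blast
        then show ?thesis
          using True unfolding k_def extend_system_def by (auto split: if_splits)
      next
        case False
        then have "f i \<notin> B j" using i j R(5) DT by blast
        then show ?thesis
          using False j R(1) le unfolding k_def system_le_def by auto
      qed
      then show ?thesis by blast
    qed
    ultimately have "card (k ` D) + card (R \<inter> S) \<le> r"
      using card_partial_transversal_avoiding R(1) by (metis le_infI1)
    moreover have "card D = Suc (r - card (R \<inter> S))"
    proof -
      have "card (?T - R \<inter> S) = r - card (R \<inter> S)"
        using R(1) by (subst card_Diff_subset) (auto intro: finite_subset)
      then show ?thesis unfolding D_def using R(2) S(2) by simp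
    qed
    ultimately show False
      using card_image[OF injk] by simp
  qed
  then have "partial_transversal r ?A (g ` ?T)"
    using g(1) unfolding bad_def by (intro partial_transversal_image) auto
  then show ?thesis using g(3) partial_transversal_subset by blast
qed

text \<open>A largest independent set has \<open>r\<close> elements, so matching it uses all
  indices. Here the convention that the number of sets equals the rank enters.\<close>

lemma full_matching_of_rank:
  assumes "matroid M" "matroid_rank M = r" "presentation M r A"
  obtains m where "inj_on m {1..r}" "\<forall>i\<in>{1..r}. m i \<in> A i"
proof -
  have "finite (ground M)" "indeps M \<subseteq> Pow (ground M)" and ne: "{} \<in> indeps M"
    using assms(1) unfolding matroid_def by simp_all blast
  then have "finite (card ` indeps M)" by (meson finite_Pow_iff finite_imageI finite_subset)
  moreover have "card ` indeps M \<noteq> {}" using ne by blast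
  ultimately have "r \<in> card ` indeps M"
    using Max_in assms(2) unfolding matroid_rank_def by blast
  then obtain X where X: "X \<in> indeps M" "card X = r" by blast
  have "indeps M = {X. X \<subseteq> ground M \<and> partial_transversal r A X}"
    using assms(3) unfolding presentation_def transversal_matroid_of_def
    by (metis matroid_data.select_convs(2))
  then obtain D g where D: "D \<subseteq> {1..r}" "inj_on g D" "g ` D = X" "\<And>i. i \<in> D \<Longrightarrow> g i \<in> A i"
    using X(1) partial_transversalE[of r A X] by blast
  have "D = {1..r}"
    using D X(2) card_image[OF D(2)] by (intro card_subset_eq) auto
  then show thesis using D that by blast
qed

theorem theorem3p2:
  fixes M :: "'a matroid_data"
    and r :: nat
    and A B :: "nat \<Rightarrow> 'a set"
    and x :: 'a
  assumes "transversal_matroid M"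
    and "matroid_rank M = r"
    and "presentation M r A"
    and "presentation M r B"
    and "system_le r A B"
    and "x \<notin> ground M"
  shows "sublattice_of_sets (closed_index_sets (ground M) x r B) (closed_index_sets (ground M) x r A) \<and>
         (\<forall>I\<in>closed_index_sets (ground M) x r B.
            extension_matroid (ground M) x r A I = extension_matroid (ground M) x r B I)"
proof -
  have "matroid M" using assms(1) unfolding transversal_matroid_def by blast
  note full = full_matching_of_rank[OF this assms(2)]
  obtain a where a: "inj_on a {1..r}" "\<forall>i\<in>{1..r}. a i \<in> A i" using full[OF assms(3)] by metis
  obtain b where b: "inj_on b {1..r}" "\<forall>i\<in>{1..r}. b i \<in> B i" using full[OF assms(4)] by metis
  have ss: "set_system (ground M) r A" "set_system (ground M) r B"
    using assms(3,4) unfolding presentation_def by auto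
  have "transversal_matroid_of (ground M) r A = transversal_matroid_of (ground M) r B"
    using assms(3,4) unfolding presentation_def by metis
  then have BA: "partial_transversal r A X" if "partial_transversal r B X" for X
    using that partial_transversal_subset_ground[OF ss(2) that]
    unfolding transversal_matroid_of_def by auto
  have "closed_index_sets (ground M) x r B \<subseteq> closed_index_sets (ground M) x r A"
  proof
    fix I assume "I \<in> closed_index_sets (ground M) x r B"
    then show "I \<in> closed_index_sets (ground M) x r A"
      unfolding closed_index_sets_iff[OF ss(1) assms(6) a] closed_index_sets_iff[OF ss(2) assms(6) b]
      using tight_set_antimono[OF _ assms(5) BA] by meson
  qed
  moreover have "extension_matroid (ground M) x r A I = extension_matroid (ground M) x r B I"
    if I: "I \<in> closed_index_sets (ground M) x r B" for I
  proof -
    have "partial_transversal r (extend_system x B I) X" if "partial_transversal r (extend_system x A I) X" for X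
      using that assms(5) by (elim partial_transversal_mono) (force simp: extend_system_def system_le_def split: if_splits)
    then show ?thesis
      using extension_partial_transversal[OF ss(2) assms(6) b assms(5) BA I]
      unfolding extension_matroid_def transversal_matroid_of_def by auto
  qed
  ultimately show ?thesis
    unfolding sublattice_of_sets_def
    using lattice_of_closed_index_sets[OF ss(1) assms(6) a] lattice_of_closed_index_sets[OF ss(2) assms(6) b]
    by blast
qed

end
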